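(* Let $f\colon\mathbf{R}^N\to\mathbf{R}$ be lower semicontinuous. Then $f$ is quasiconvex on $\mathbf{R}^N$ if and only if $$ f\left(\int_\Omega X\,d\mu\right)\le \operatorname{ess\,sup}_{\Omega} f\circ X $$ for all measure spaces $(\Omega,\mu)$ with $\mu(\Omega)=1$ and all $\mathbf{R}^N$-valued integrable functions $X$ on $\Omega$.
   Context: A function $f\colon\mathbf{R}^N\to\mathbf{R}$ is quasiconvex if $f(\theta p+(1-\theta)q)\le\max\{f(p),f(q)\}$ for all $p,q\in\mathbf{R}^N$ and $0\le\theta\le1$. The essential supremum is taken with respect to $\mu$ and may be $+\infty$. *)

theory Defs
  imports "HOL-Probability.Probability"
begin

definition lower_semicontinuous :: "('a::topological_space \<Rightarrow> real) \<Rightarrow> bool" where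
  "lower_semicontinuous f \<longleftrightarrow> (\<forall>x. \<forall>y < f x. \<forall>\<^sub>F z in nhds x. y < f z)"

definition quasiconvex :: "('a::real_vector \<Rightarrow> real) \<Rightarrow> bool" where
  "quasiconvex f \<longleftrightarrow>
     (\<forall>p q. \<forall>\<theta>. 0 \<le> \<theta> \<and> \<theta> \<le> 1 \<longrightarrow>
        f (\<theta> *\<^sub>R p + (1 - \<theta>) *\<^sub>R q) \<le> max (f p) (f q))"

text \<open>
  The essential supremum is the library's \<^const>\<open>esssup\<close>, taken in the extended reals so that the
  value \<open>+\<infinity>\<close> is admitted. By convention it is \<open>+\<infinity>\<close> for a non-measurable function; this never
  applies to \<open>f \<circ> X\<close> with \<open>f\<close> lower semicontinuous and \<open>X\<close> integrable, which is Borel measurable.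

  ``All probability spaces'' ranges over all types of sample points, and HOL cannot
  quantify over types inside a formula. An equivalence claimed for every type \<open>'w\<close> would be false on
  a one-element type, where the only probability measure is a point mass. The theorem therefore
  states the equivalence with sample points in \<^typ>\<open>real\<close>, and the direction from quasiconvexity
  also for an arbitrary type \<open>'w\<close>. Thus quasiconvexity yields the inequality on every probability
  space, and conversely the inequality on every probability space, in particular on those with
  \<open>\<Omega> \<subseteq> \<real>\<close>, yields quasiconvexity.
\<close>

end

theory Submission
  imports Defs
begin

text \<open>
  Up to a null set, \<open>X\<close> takes its values in the sublevel set of \<open>f\<close> at the height of the essential
  supremum. This set is closed by lower semicontinuity and convex by quasiconvexity, and by the
  separation theorem the mean of \<open>X\<close> cannot lie outside it. Conversely, quasiconvexity is the
  inequality for random variables taking at most two values.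
\<close>

lemma closed_sublevel_lower_semicontinuous:
  fixes f :: "'a::topological_space \<Rightarrow> real"
  assumes "lower_semicontinuous f"
  shows "closed {x. f x \<le> c}"
proof -
  have "open {x. c < f x}"
  proof (subst open_subopen, intro ballI)
    fix x assume "x \<in> {x. c < f x}"
    then have "\<forall>\<^sub>F z in nhds x. c < f z"
      using assms by (simp add: lower_semicontinuous_def)
    then show "\<exists>T. open T \<and> x \<in> T \<and> T \<subseteq> {x. c < f x}"
      by (auto simp: eventually_nhds)
  qed
  moreover have "- {x. f x \<le> c} = {x. c < f x}"
    by auto
  ultimately show ?thesis
    by (simp add: closed_def)
qed

lemma convex_sublevel_quasiconvex:
  assumes "quasiconvex f"
  shows "convex {x. f x \<le> c}"
proof (rule convexI)
  fix x y u v
  assume "x \<in> {x. f x \<le> c}" "y \<in> {x. f x \<le> c}" "0 \<le> u" "0 \<le> v" "u + v = (1::real)"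
  moreover from this have "v = 1 - u" "u \<le> 1"
    by auto
  moreover have "f (u *\<^sub>R x + (1 - u) *\<^sub>R y) \<le> max (f x) (f y)"
    using assms \<open>0 \<le> u\<close> \<open>u \<le> 1\<close> unfolding quasiconvex_def by blast
  ultimately show "u *\<^sub>R x + v *\<^sub>R y \<in> {x. f x \<le> c}"
    by auto
qed

text \<open>A point outside \<open>S\<close> is strictly separated from \<open>S\<close> by a linear
  functional \<open>a\<close>, and \<open>a\<close> commutes with the integral. A bound valid almost
  everywhere on \<open>S\<close> thus passes to the mean.\<close>

lemma (in prob_space) integral_in_closed_convex:
  fixes X :: "'a \<Rightarrow> 'b::euclidean_space"
  assumes X: "integrable M X" and S: "closed S" "convex S" and AE: "AE \<omega> in M. X \<omega> \<in> S"
  shows "integral\<^sup>L M X \<in> S"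
proof (rule ccontr)
  assume "integral\<^sup>L M X \<notin> S"
  then obtain a b where ab: "a \<bullet> integral\<^sup>L M X < b" "\<And>x. x \<in> S \<Longrightarrow> b < a \<bullet> x"
    using separating_hyperplane_closed_point[OF S(2,1)] by blast
  \<comment> \<open>Integrating over total mass 1 keeps the constant \<open>b\<close>. The weak
    inequality suffices, since the mean lies strictly on the other side.\<close>
  have "b \<le> (\<integral>\<omega>. a \<bullet> X \<omega> \<partial>M)"
    using AE ab(2) X by (intro integral_ge_const) (auto elim!: eventually_mono intro: less_imp_le)
  also have "\<dots> = a \<bullet> integral\<^sup>L M X"
    using X by simp
  finally show False
    using ab(1) by simp
qed

lemma (in prob_space) jensen_quasiconvex:
  fixes f :: "'b::euclidean_space \<Rightarrow> real"
  assumes lsc: "lower_semicontinuous f" and qc: "quasiconvex f" and X: "integrable M X"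
  shows "ereal (f (integral\<^sup>L M X)) \<le> esssup M (\<lambda>\<omega>. ereal (f (X \<omega>)))"
proof -
  \<comment> \<open>Measurability is no issue here: \<open>esssup\<close> of a non-measurable
    function is \<infinity> by default.\<close>
  have AE: "AE \<omega> in M. ereal (f (X \<omega>)) \<le> esssup M (\<lambda>\<omega>. ereal (f (X \<omega>)))"
    by (rule esssup_AE)
  show ?thesis
  proof (cases "esssup M (\<lambda>\<omega>. ereal (f (X \<omega>)))")
    case (real c)
    have "AE \<omega> in M. X \<omega> \<in> {x. f x \<le> c}"
      using AE real by simp
    then have "integral\<^sup>L M X \<in> {x. f x \<le> c}"
      by (rule integral_in_closed_convex[OF X closed_sublevel_lower_semicontinuous[OF lsc]
            convex_sublevel_quasiconvex[OF qc]])
    then show ?thesis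
      using real by simp
  next
    \<comment> \<open>As \<open>f\<close> is real-valued, \<open>AE\<close> would say that
      \<open>False\<close> holds almost everywhere, which total mass 1 excludes.\<close>
    case MInf
    then show ?thesis
      using AE by (simp add: AE_False)
  qed simp
qed

lemma quasiconvex_if_jensen:
  fixes f :: "'b::euclidean_space \<Rightarrow> real"
  assumes jensen: "\<And>(M :: real measure) X. prob_space M \<Longrightarrow> integrable M X \<Longrightarrow>
    ereal (f (integral\<^sup>L M X)) \<le> esssup M (\<lambda>\<omega>. ereal (f (X \<omega>)))"
  shows "quasiconvex f"
  unfolding quasiconvex_def
proof (intro allI impI)
  fix p q :: 'b and \<theta> :: real
  assume \<theta>: "0 \<le> \<theta> \<and> \<theta> \<le> 1"
  \<comment> \<open>\<open>P\<close> has mass \<theta> at 1 and 1 - \<theta> at 0. The Bernoulli law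
    is moved from \<open>bool\<close> to \<open>real\<close> because \<open>jensen\<close> is
    assumed only for real sample points.\<close>
  define P :: "real pmf" where "P = map_pmf of_bool (bernoulli_pmf \<theta>)"
  define X :: "real \<Rightarrow> 'b" where "X = (\<lambda>\<omega>. if \<omega> = 1 then p else q)"
  have "finite (set_pmf P)"
    by (simp add: P_def)
  then have int: "integrable (measure_pmf P) X"
    by (rule integrable_measure_pmf_finite)
  have mean: "integral\<^sup>L (measure_pmf P) X = \<theta> *\<^sub>R p + (1 - \<theta>) *\<^sub>R q"
    using \<theta> by (simp add: P_def X_def integral_measure_pmf[where A = UNIV] UNIV_bool)
  have "ereal (f (integral\<^sup>L (measure_pmf P) X)) \<le> esssup (measure_pmf P) (\<lambda>\<omega>. ereal (f (X \<omega>)))"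
    using int by (rule jensen[OF prob_space_measure_pmf])
  also have "\<dots> \<le> ereal (max (f p) (f q))"
    \<comment> \<open>The bound holds at every sample point, as \<open>X\<close> takes only the
      values \<open>p\<close> and \<open>q\<close>.\<close>
    by (rule esssup_I) (simp_all add: X_def)
  finally show "f (\<theta> *\<^sub>R p + (1 - \<theta>) *\<^sub>R q) \<le> max (f p) (f q)"
    by (simp add: mean del: ereal_max)
qed

theorem lemma1p1:
  fixes f :: "real ^ 'n \<Rightarrow> real"
  assumes "lower_semicontinuous f"
  shows "(quasiconvex f \<longleftrightarrow>
            (\<forall>(M :: real measure) (X :: real \<Rightarrow> real ^ 'n).
               prob_space M \<and> integrable M X \<longrightarrow>
                 ereal (f (integral\<^sup>L M X)) \<le> esssup M (\<lambda>\<omega>. ereal (f (X \<omega>)))))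
       \<and> (quasiconvex f \<longrightarrow>
            (\<forall>(M :: 'w measure) (X :: 'w \<Rightarrow> real ^ 'n).
               prob_space M \<and> integrable M X \<longrightarrow>
                 ereal (f (integral\<^sup>L M X)) \<le> esssup M (\<lambda>\<omega>. ereal (f (X \<omega>)))))"
proof (intro conjI iffI allI impI)
  show "quasiconvex f"
    if "\<forall>(M :: real measure) (X :: real \<Rightarrow> real ^ 'n).
          prob_space M \<and> integrable M X \<longrightarrow>
            ereal (f (integral\<^sup>L M X)) \<le> esssup M (\<lambda>\<omega>. ereal (f (X \<omega>)))"
    by (rule quasiconvex_if_jensen) (simp add: that)
\<comment> \<open>What remains is the forward implication twice, for sample points in
  \<open>real\<close> and in the arbitrary type.\<close>
qed (erule conjE, erule (2) prob_space.jensen_quasiconvex[OF _ assms])+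

end
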